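(* For a simple connected finite graph $G$, $h(T(G))=|E(G)|$ if and only if $G$ has no internal vertices.
   Context: An internal vertex of $G$ is a vertex of degree at least $2$ (i.e. adjacent to at least two vertices). The total graph $T(G)$ has vertex set $V(G)\cup E(G)$, two elements being adjacent in $T(G)$ if and only if they are adjacent or incident in $G$ (two vertices adjacent in $G$, two edges sharing an endpoint, or a vertex and an edge incident to it). The primitive hole number $h(H)$ of a graph $H$ is the number of triangles (cycles $C_3$) in $H$, with $h(H)=0$ if there are none. *)

theory Defs
  imports Main
begin

record 'a sgraph =
  verts :: "'a set"
  edges :: "'a set set"

definition finite_simple_graph :: "'a sgraph \<Rightarrow> bool" where
  "finite_simple_graph G \<longleftrightarrow>
     finite (verts G) \<and> (\<forall>e\<in>edges G. e \<subseteq> verts G \<and> card e = 2)"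

definition adjacent :: "'a sgraph \<Rightarrow> 'a \<Rightarrow> 'a \<Rightarrow> bool" where
  "adjacent G u v \<longleftrightarrow> {u, v} \<in> edges G"

definition connected_graph :: "'a sgraph \<Rightarrow> bool" where
  "connected_graph G \<longleftrightarrow>
     verts G \<noteq> {} \<and> (\<forall>u\<in>verts G. \<forall>v\<in>verts G. (adjacent G)\<^sup>*\<^sup>* u v)"

definition degree :: "'a sgraph \<Rightarrow> 'a \<Rightarrow> nat" where
  "degree G v = card {w \<in> verts G. adjacent G v w}"

definition internal_vertex :: "'a sgraph \<Rightarrow> 'a \<Rightarrow> bool" where
  "internal_vertex G v \<longleftrightarrow> v \<in> verts G \<and> degree G v \<ge> 2"

definition total_graph :: "'a sgraph \<Rightarrow> ('a + 'a set) sgraph" where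
  "total_graph G =
     \<lparr>verts = Inl ` verts G \<union> Inr ` edges G,
      edges = {{Inl u, Inl v} | u v. u \<in> verts G \<and> v \<in> verts G \<and> adjacent G u v}
            \<union> {{Inr e, Inr f} | e f. e \<in> edges G \<and> f \<in> edges G \<and> e \<noteq> f \<and> e \<inter> f \<noteq> {}}
            \<union> {{Inl v, Inr e} | v e. v \<in> verts G \<and> e \<in> edges G \<and> v \<in> e}\<rparr>"

text \<open>Triangles are counted as subgraphs, so the six labellings of a triangle by
  \<open>x\<close>, \<open>y\<close>, \<open>z\<close> give a single element.\<close>

definition triangles :: "'a sgraph \<Rightarrow> 'a sgraph set" where
  "triangles H =
     {\<lparr>verts = {x, y, z}, edges = {{x, y}, {y, z}, {z, x}}\<rparr> | x y z.
        {x, y, z} \<subseteq> verts H \<and> x \<noteq> y \<and> y \<noteq> z \<and> z \<noteq> x \<and>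
        adjacent H x y \<and> adjacent H y z \<and> adjacent H z x}"

definition primitive_hole_number :: "'a sgraph \<Rightarrow> nat" where
  "primitive_hole_number H = card (triangles H)"

lemma finite_simple_graph_total_graph:
  assumes "finite_simple_graph G"
  shows "finite_simple_graph (total_graph G)"
proof -
  have "edges G \<subseteq> Pow (verts G)" "finite (verts G)"
    using assms by (auto simp: finite_simple_graph_def)
  then have "finite (edges G)"
    by (meson finite_Pow_iff finite_subset)
  moreover have "u \<noteq> v" if "adjacent G u v" for u v
    using assms that by (auto simp: finite_simple_graph_def adjacent_def)
  ultimately show ?thesis
    using assms by (auto simp: finite_simple_graph_def total_graph_def card_insert_if)
qed

lemma finite_triangles:
  assumes "finite_simple_graph H"
  shows "finite (triangles H)"
proof -
  have "triangles H \<subseteq> (\<lambda>(x, y, z). \<lparr>verts = {x, y, z}, edges = {{x, y}, {y, z}, {z, x}}\<rparr>) `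
          (verts H \<times> verts H \<times> verts H)"
    by (auto simp: triangles_def image_iff) blast
  then show ?thesis
    using assms by (auto simp: finite_simple_graph_def intro: finite_subset)
qed

end

theory Submission imports Defs begin

text \<open>Every edge of \<open>G\<close> forms a triangle of \<open>T(G)\<close> together with its two endpoints, so
  \<open>h(T(G)) = |E(G)|\<close> means that there are no other triangles. Two edges meeting in an internal
  vertex form another triangle together with that vertex. Without internal vertices the edges are
  pairwise disjoint, so a triangle of \<open>T(G)\<close> contains at most one edge of \<open>G\<close>; it also contains
  at most two vertices of \<open>G\<close>, and hence is the triangle of an edge.\<close>

lemma adjacent_commute: "adjacent G u v \<longleftrightarrow> adjacent G v u"
  by (simp add: adjacent_def insert_commute)

text \<open>Mixed pairs are covered in both orders, so the simplifier decides adjacency for every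
  combination of \<open>Inl\<close> and \<open>Inr\<close>.\<close>

lemma adjacent_total_graph [simp]:
  "adjacent (total_graph G) (Inl u) (Inl v) \<longleftrightarrow> u \<in> verts G \<and> v \<in> verts G \<and> adjacent G u v"
  "adjacent (total_graph G) (Inr e) (Inr f) \<longleftrightarrow>
     e \<in> edges G \<and> f \<in> edges G \<and> e \<noteq> f \<and> e \<inter> f \<noteq> {}"
  "adjacent (total_graph G) (Inl v) (Inr e) \<longleftrightarrow> v \<in> verts G \<and> e \<in> edges G \<and> v \<in> e"
  "adjacent (total_graph G) (Inr e) (Inl v) \<longleftrightarrow> v \<in> verts G \<and> e \<in> edges G \<and> v \<in> e"
  by (auto simp: adjacent_def total_graph_def doubleton_eq_iff insert_commute)

lemma verts_total_graph [simp]: "verts (total_graph G) = Inl ` verts G \<union> Inr ` edges G"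
  by (simp add: total_graph_def)

text \<open>The complete graph on \<open>S\<close>. For three distinct vertices it is the triangle
  on them, now a function of the vertex set alone, so relabelling is just
  \<open>insert_commute\<close>.\<close>

definition triangle_on :: "'a set \<Rightarrow> 'a sgraph" where
  "triangle_on S = \<lparr>verts = S, edges = {{x, y} | x y. x \<in> S \<and> y \<in> S \<and> x \<noteq> y}\<rparr>"

lemma verts_triangle_on [simp]: "verts (triangle_on S) = S"
  by (simp add: triangle_on_def)

lemma triangle_on_insert3:
  assumes "x \<noteq> y" "y \<noteq> z" "z \<noteq> x"
  shows "triangle_on {x, y, z} = \<lparr>verts = {x, y, z}, edges = {{x, y}, {y, z}, {z, x}}\<rparr>"
proof -
  have "{{a, b} | a b. a \<in> {x, y, z} \<and> b \<in> {x, y, z} \<and> a \<noteq> b} = {{x, y}, {y, z}, {z, x}}"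
    using assms by (auto simp: insert_commute)
  then show ?thesis
    by (simp add: triangle_on_def)
qed

lemma triangle_onI:
  assumes "{x, y, z} \<subseteq> verts H" "x \<noteq> y" "y \<noteq> z" "z \<noteq> x"
    "adjacent H x y" "adjacent H y z" "adjacent H z x"
  shows "triangle_on {x, y, z} \<in> triangles H"
  unfolding triangles_def triangle_on_insert3[OF assms(2-4)] using assms by blast

lemma trianglesE:
  assumes "t \<in> triangles H"
  obtains x y z where "t = triangle_on {x, y, z}" "{x, y, z} \<subseteq> verts H"
    "x \<noteq> y" "y \<noteq> z" "z \<noteq> x" "adjacent H x y" "adjacent H y z" "adjacent H z x"
proof -
  obtain x y z where *: "t = \<lparr>verts = {x, y, z}, edges = {{x, y}, {y, z}, {z, x}}\<rparr>"
    "{x, y, z} \<subseteq> verts H" "x \<noteq> y" "y \<noteq> z" "z \<noteq> x"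
    "adjacent H x y" "adjacent H y z" "adjacent H z x"
    using assms unfolding triangles_def by blast
  then show thesis
    using that[of x y z] by (simp add: triangle_on_insert3)
qed

text \<open>Taking the image of \<open>e\<close> under \<open>Inl\<close> avoids choosing an order
  of the two endpoints.\<close>

definition edge_triangle :: "'a set \<Rightarrow> ('a + 'a set) sgraph" where
  "edge_triangle e = triangle_on (insert (Inr e) (Inl ` e))"

text \<open>The edge can be read off from its triangle. This gives injectivity and excludes
  triangles that contain two edges.\<close>

lemma Inr_in_verts_edge_triangle [simp]: "Inr f \<in> verts (edge_triangle e) \<longleftrightarrow> f = e"
  by (auto simp: edge_triangle_def)

lemma inj_edge_triangle: "inj edge_triangle"
  by (metis injI Inr_in_verts_edge_triangle)

lemma finite_simple_graph_edgeE:
  assumes "finite_simple_graph G" "e \<in> edges G"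
  obtains u v where "e = {u, v}" "u \<noteq> v" "u \<in> verts G" "v \<in> verts G"
proof -
  have "card e = 2" "e \<subseteq> verts G"
    using assms by (auto simp: finite_simple_graph_def)
  then show thesis
    using that by (auto simp: card_2_iff)
qed

lemma edge_triangle_in_triangles:
  assumes "finite_simple_graph G" "e \<in> edges G"
  shows "edge_triangle e \<in> triangles (total_graph G)"
proof -
  obtain u v where uv: "e = {u, v}" "u \<noteq> v" "u \<in> verts G" "v \<in> verts G"
    using assms by (rule finite_simple_graph_edgeE)
  moreover have "adjacent G u v"
    using assms(2) uv by (simp add: adjacent_def)
  ultimately have "triangle_on {Inr e, Inl u, Inl v} \<in> triangles (total_graph G)"
    using assms(2) by (intro triangle_onI) simp_all
  then show ?thesis
    using uv by (simp add: edge_triangle_def)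
qed

lemma internal_vertex_iff:
  assumes "finite_simple_graph G"
  shows "internal_vertex G v \<longleftrightarrow> (\<exists>a b. a \<noteq> b \<and> adjacent G v a \<and> adjacent G v b)"
proof -
  have *: "v \<in> verts G \<and> w \<in> verts G" if "adjacent G v w" for w
    using assms that by (auto simp: finite_simple_graph_def adjacent_def)
  have "finite {w \<in> verts G. adjacent G v w}"
    using assms by (simp add: finite_simple_graph_def)
  \<comment> \<open>A finite set has at most one element iff any two of its elements are equal; this
    is negated to get two distinct neighbours.\<close>
  from card_le_Suc0_iff_eq[OF this]
  have "\<not> degree G v \<le> Suc 0 \<longleftrightarrow>
      (\<exists>a b. a \<in> verts G \<and> b \<in> verts G \<and> a \<noteq> b \<and> adjacent G v a \<and> adjacent G v b)"
    unfolding degree_def by blast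
  moreover have "degree G v \<ge> 2 \<longleftrightarrow> \<not> degree G v \<le> Suc 0"
    by linarith
  ultimately have "degree G v \<ge> 2 \<longleftrightarrow>
      (\<exists>a b. a \<in> verts G \<and> b \<in> verts G \<and> a \<noteq> b \<and> adjacent G v a \<and> adjacent G v b)"
    by blast
  then show ?thesis
    unfolding internal_vertex_def using * by blast
qed

text \<open>Write the edges as \<open>{v, a}\<close> and \<open>{v, b}\<close>: if \<open>a\<close>
  and \<open>b\<close> differed, \<open>v\<close> would have two neighbours.\<close>

lemma edges_eq_if_no_internal_vertex:
  assumes "finite_simple_graph G" "\<nexists>v. internal_vertex G v"
    and "e \<in> edges G" "f \<in> edges G" "v \<in> e" "v \<in> f"
  shows "e = f"
proof -
  have "\<exists>w. g = {v, w}" if "g \<in> edges G" "v \<in> g" for g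
    using assms(1) that(1) by (rule finite_simple_graph_edgeE) (use that(2) in auto)
  then obtain a b where "e = {v, a}" "f = {v, b}"
    using assms(3-6) by meson
  then show ?thesis
    using assms(1-4) by (auto simp: internal_vertex_iff adjacent_def)
qed

text \<open>Two distinct members of a two-element set exhaust it, so incidence of \<open>u\<close>
  and \<open>v\<close> with \<open>e\<close> already determines the triangle.\<close>

lemma edge_triangle_eq:
  assumes "finite_simple_graph G" "e \<in> edges G" "u \<in> e" "v \<in> e" "u \<noteq> v"
  shows "edge_triangle e = triangle_on {Inr e, Inl u, Inl v}"
proof -
  have "e = {u, v}"
    using assms(1,2) by (rule finite_simple_graph_edgeE) (use assms(3-5) in auto)
  then show ?thesis
    by (simp add: edge_triangle_def)
qed

lemma triangles_total_graph_if_no_internal_vertex: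
  assumes G: "finite_simple_graph G" and no: "\<nexists>v. internal_vertex G v"
    and t: "t \<in> triangles (total_graph G)"
  shows "t \<in> edge_triangle ` edges G"
proof -
  obtain x y z where xyz: "t = triangle_on {x, y, z}" "x \<noteq> y" "y \<noteq> z" "z \<noteq> x"
    "adjacent (total_graph G) x y" "adjacent (total_graph G) y z" "adjacent (total_graph G) z x"
    using t by (rule trianglesE)
  have disjoint: "\<not> adjacent (total_graph G) (Inr e) (Inr f)" for e f
    using edges_eq_if_no_internal_vertex[OF G no] by auto
  \<comment> \<open>Otherwise \<open>a\<close> would be internal. The orientation matches the cyclic
    order in which a triangle's adjacencies are given.\<close>
  have no_path: "b = c" if "adjacent G a b" "adjacent G c a" for a b c
    using no that by (metis internal_vertex_iff[OF G] adjacent_commute)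
  have edge: "triangle_on {Inr e, Inl u, Inl v} \<in> edge_triangle ` edges G"
    if "e \<in> edges G" "u \<in> e" "v \<in> e" "u \<noteq> v" for e u v
    using edge_triangle_eq[OF G that] that(1) by (metis imageI)
  \<comment> \<open>Of the eight constructor patterns, \<open>disjoint\<close> rules out the four
    with at least two edges of \<open>G\<close>.\<close>
  consider (none) a b c where "x = Inl a" "y = Inl b" "z = Inl c"
    | (x) e u v where "x = Inr e" "y = Inl u" "z = Inl v"
    | (y) e u v where "y = Inr e" "x = Inl u" "z = Inl v"
    | (z) e u v where "z = Inr e" "x = Inl u" "y = Inl v"
    using xyz(5-7) disjoint by (cases x; cases y; cases z) auto
  then show ?thesis
  proof cases
    case none
    then show ?thesis using xyz no_path[of a b c] by auto
  next
    case x
    then show ?thesis using xyz edge[of e u v] by auto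
  next
    case y
    then show ?thesis using xyz edge[of e u v] by (auto simp: insert_commute)
  next
    case z
    then show ?thesis using xyz edge[of e u v] by (auto simp: insert_commute)
  qed
qed

lemma triangle_at_internal_vertex:
  assumes G: "finite_simple_graph G" and "internal_vertex G v"
  shows "\<exists>t \<in> triangles (total_graph G). t \<notin> edge_triangle ` edges G"
proof -
  obtain a b where ab: "a \<noteq> b" "{v, a} \<in> edges G" "{v, b} \<in> edges G"
    using assms by (auto simp: internal_vertex_iff adjacent_def)
  let ?t = "triangle_on {Inl v, Inr {v, a}, Inr {v, b}}"
  have ne: "{v, a} \<noteq> {v, b}"
    using ab(1) by (auto simp: doubleton_eq_iff)
  have "v \<in> verts G"
    using assms(2) by (simp add: internal_vertex_def)
  with ab ne have "?t \<in> triangles (total_graph G)"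
    by (intro triangle_onI) simp_all
  \<comment> \<open>\<open>?t\<close> has two distinct edges of \<open>G\<close> among its vertices,
    whereas \<open>edge_triangle e\<close> has only \<open>e\<close>.\<close>
  moreover have "?t \<noteq> edge_triangle e" for e
  proof
    assume "?t = edge_triangle e"
    then have "Inr {v, a} \<in> verts (edge_triangle e)" "Inr {v, b} \<in> verts (edge_triangle e)"
      by (metis insertI1 insertI2 verts_triangle_on)+
    with ne show False by simp
  qed
  ultimately show ?thesis by blast
qed

theorem theorem2p10:
  fixes G :: "'a sgraph"
  assumes "finite_simple_graph G" and "connected_graph G"
  shows "primitive_hole_number (total_graph G) = card (edges G)
         \<longleftrightarrow> (\<nexists>v. internal_vertex G v)"
proof -
  let ?T = "triangles (total_graph G)"
  have sub: "edge_triangle ` edges G \<subseteq> ?T"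
    using edge_triangle_in_triangles[OF assms(1)] by blast
  have "finite ?T"
    using assms(1) by (intro finite_triangles finite_simple_graph_total_graph)
  moreover have "card (edge_triangle ` edges G) = card (edges G)"
    by (intro card_image inj_on_subset[OF inj_edge_triangle]) simp
  \<comment> \<open>A subset of a finite set has the same cardinality only if it is the whole
    set.\<close>
  ultimately have "card ?T = card (edges G) \<longleftrightarrow> edge_triangle ` edges G = ?T"
    using sub by (metis card_subset_eq)
  also have "\<dots> \<longleftrightarrow> (\<nexists>v. internal_vertex G v)"
  proof
    assume "edge_triangle ` edges G = ?T"
    then show "\<nexists>v. internal_vertex G v"
      using triangle_at_internal_vertex[OF assms(1)] by auto
  next
    assume "\<nexists>v. internal_vertex G v"
    then have "?T \<subseteq> edge_triangle ` edges G"
      by (intro subsetI triangles_total_graph_if_no_internal_vertex[OF assms(1)])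
    with sub show "edge_triangle ` edges G = ?T"
      by (rule equalityI)
  qed
  finally show ?thesis
    by (simp add: primitive_hole_number_def)
qed

end
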